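(* For every convex space $A$, the measurable space $\Sigma A$ (the underlying set of $A$ with the $\sigma$-algebra generated by the Boolean subobjects of $A$) is separated: for any two distinct points $a_1,a_2\in A$ there is a measurable subset $U$ of $\Sigma A$ that contains one of them and not the other.
   Context: A convex space is a (possibly empty) set $A$ together with, for each sequence $\alpha=(\alpha_i)_{i\in\mathbb{N}}$ in $[0,1]$ with only finitely many nonzero terms and $\sum_i\alpha_i=1$, an operation $A^{\mathbb{N}}\to A$, written $(a_i)\mapsto\sum_i\alpha_i a_i$, such that (1) $\sum_i e^j_i a_i=a_j$, where $e^j_i=1$ if $i=j$ and $0$ otherwise; (2) $\sum_i\alpha_i\big(\sum_j\beta^i_j a_j\big)=\sum_j\big(\sum_i\alpha_i\beta^i_j\big)a_j$. A Boolean subobject of a convex space $A$ is a subset $A_0\subseteq A$, closed under convex combinations, whose set-theoretic complement in $A$ is also closed under convex combinations. *)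

theory Defs
  imports "HOL-Analysis.Analysis"
begin

definition convex_coeffs :: "(nat \<Rightarrow> real) set" where
  "convex_coeffs =
     {\<alpha>. (\<forall>i. 0 \<le> \<alpha> i \<and> \<alpha> i \<le> 1) \<and> finite {i. \<alpha> i \<noteq> 0} \<and> (\<Sum>i | \<alpha> i \<noteq> 0. \<alpha> i) = 1}"

(* The underlying set is an explicit carrier, which may be empty. The operation cc is only
   constrained on coefficient sequences in convex_coeffs and sequences of points of A.
   In the associativity law the sum over i is restricted to the support of \<alpha>, where all its
   nonzero terms lie. *)
locale convex_space =
  fixes A :: "'a set" and cc :: "(nat \<Rightarrow> real) \<Rightarrow> (nat \<Rightarrow> 'a) \<Rightarrow> 'a"
  assumes cc_closed:
      "\<And>\<alpha> a. \<lbrakk>\<alpha> \<in> convex_coeffs; \<And>i. a i \<in> A\<rbrakk> \<Longrightarrow> cc \<alpha> a \<in> A"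
    and cc_unit:
      "\<And>j a. (\<And>i. a i \<in> A) \<Longrightarrow> cc (\<lambda>i. if i = j then 1 else 0) a = a j"
    and cc_assoc:
      "\<And>\<alpha> \<beta> a. \<lbrakk>\<alpha> \<in> convex_coeffs; \<And>i. \<beta> i \<in> convex_coeffs; \<And>j. a j \<in> A\<rbrakk> \<Longrightarrow>
         cc \<alpha> (\<lambda>i. cc (\<beta> i) a) = cc (\<lambda>j. \<Sum>i | \<alpha> i \<noteq> 0. \<alpha> i * \<beta> i j) a"

definition closed_under_cc :: "((nat \<Rightarrow> real) \<Rightarrow> (nat \<Rightarrow> 'a) \<Rightarrow> 'a) \<Rightarrow> 'a set \<Rightarrow> bool" where
  "closed_under_cc cc S \<longleftrightarrow> (\<forall>\<alpha>\<in>convex_coeffs. \<forall>a. (\<forall>i. a i \<in> S) \<longrightarrow> cc \<alpha> a \<in> S)"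

definition boolean_subobject ::
    "'a set \<Rightarrow> ((nat \<Rightarrow> real) \<Rightarrow> (nat \<Rightarrow> 'a) \<Rightarrow> 'a) \<Rightarrow> 'a set \<Rightarrow> bool" where
  "boolean_subobject A cc S \<longleftrightarrow> S \<subseteq> A \<and> closed_under_cc cc S \<and> closed_under_cc cc (A - S)"

(* Measurable spaces are represented by measures; sigma equips the space with the zero measure. *)
definition Sigma_space :: "'a set \<Rightarrow> ((nat \<Rightarrow> real) \<Rightarrow> (nat \<Rightarrow> 'a) \<Rightarrow> 'a) \<Rightarrow> 'a measure" where
  "Sigma_space A cc = sigma A {S. boolean_subobject A cc S}"

lemma space_Sigma_space: "space (Sigma_space A cc) = A"
  unfolding Sigma_space_def boolean_subobject_def by (rule space_measure_of) auto

lemma sets_Sigma_space: "sets (Sigma_space A cc) = sigma_sets A {S. boolean_subobject A cc S}"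
  unfolding Sigma_space_def boolean_subobject_def by (rule sets_measure_of) auto

definition separated_space :: "'a measure \<Rightarrow> bool" where
  "separated_space M \<longleftrightarrow>
     (\<forall>x\<in>space M. \<forall>y\<in>space M. x \<noteq> y \<longrightarrow>
        (\<exists>U\<in>sets M. (x \<in> U \<and> y \<notin> U) \<or> (y \<in> U \<and> x \<notin> U)))"

end

theory Submission
  imports Defs
begin

text \<open>
  The proof is the Kakutani--Stone separation argument, which needs neither cancellation nor an
  embedding into a vector space. By Zorn's lemma, choose a convex set \<open>C\<close> that is maximal among
  those containing \<open>a\<^sub>1\<close> but not \<open>a\<^sub>2\<close>; the singleton \<open>{a\<^sub>1}\<close> is one of them, because convex
  combinations are idempotent. It suffices that the complement of \<open>C\<close> is convex, for then \<open>C\<close> itself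
  is a Boolean subobject separating the two points.

  Let \<open>x\<close> and \<open>y\<close> lie outside \<open>C\<close>. By maximality, the convex hulls of \<open>C \<union> {x}\<close> and of \<open>C \<union> {y}\<close>
  contain \<open>a\<^sub>2\<close>, so \<open>a\<^sub>2 = r c + (1 - r) x = s d + (1 - s) y\<close> with \<open>c, d \<in> C\<close> and \<open>r, s < 1\<close>.
  Averaging the two expressions with suitable weights makes \<open>x\<close> and \<open>y\<close> occur in any prescribed
  ratio, so that \<open>a\<^sub>2\<close> is a convex combination of \<open>c\<close>, \<open>d\<close> and a given point \<open>z\<close> between \<open>x\<close> and
  \<open>y\<close>. If \<open>z\<close> were in \<open>C\<close>, then \<open>a\<^sub>2\<close> would be too.

  Everything is done with binary combinations. The regrouping law \<open>mix_regroup\<close> is the only algebra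
  required: it shows both that the hull of \<open>C \<union> {x}\<close> consists of segments and that the averaging
  above works. Binary closure suffices by \<open>closed_under_cc_if_mix_closed\<close>.
\<close>

section \<open>Coefficient sequences\<close>

definition binary_coeffs :: "real \<Rightarrow> nat \<Rightarrow> real" where
  "binary_coeffs p = (\<lambda>i. if i = 0 then p else if i = 1 then 1 - p else 0)"

text \<open>
  For \<open>a = b = 0\<close> the quotient is \<open>0\<close>, which is still a valid weight.
\<close>
lemma relative_weight:
  fixes a b :: real
  assumes "0 \<le> a" "0 \<le> b"
  shows "a / (a + b) \<in> {0..1}" "(a + b) * (a / (a + b)) = a"
proof -
  show "a / (a + b) \<in> {0..1}" using assms by (auto simp: divide_le_eq_1)
  have "a = 0" if "a + b = 0" using assms that by linarith
  then show "(a + b) * (a / (a + b)) = a" by auto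
qed

lemma convex_coeffs_iff_sum:
  assumes "finite F" "\<And>i. i \<notin> F \<Longrightarrow> \<alpha> i = 0"
  shows "\<alpha> \<in> convex_coeffs \<longleftrightarrow> (\<forall>i. 0 \<le> \<alpha> i) \<and> sum \<alpha> F = 1"
proof -
  have fin: "finite {i. \<alpha> i \<noteq> 0}"
    by (rule finite_subset[OF _ assms(1)]) (use assms(2) in auto)
  have eq: "(\<Sum>i | \<alpha> i \<noteq> 0. \<alpha> i) = sum \<alpha> F"
    by (rule sum.mono_neutral_left) (use assms in auto)
  have "\<alpha> i \<le> 1" if "\<forall>i. 0 \<le> \<alpha> i" "sum \<alpha> F = 1" for i
  proof (cases "i \<in> F")
    case True
    then show ?thesis using member_le_sum[of i F \<alpha>] that assms(1) by auto
  qed (use assms(2) in auto)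
  then show ?thesis using fin eq by (auto simp: convex_coeffs_def)
qed

lemma convex_coeffs_support:
  assumes "\<alpha> \<in> convex_coeffs"
  shows "finite {i. \<alpha> i \<noteq> 0}" "0 \<le> \<alpha> i" "\<alpha> i \<le> 1" "(\<Sum>i | \<alpha> i \<noteq> 0. \<alpha> i) = 1"
  using assms by (auto simp: convex_coeffs_def)

lemma unit_in_convex_coeffs: "(\<lambda>i. if i = j then 1 else 0) \<in> convex_coeffs"
  by (subst convex_coeffs_iff_sum[of "{j}"]) auto

lemma binary_coeffs_in_convex_coeffs:
  assumes "p \<in> {0..1}"
  shows "binary_coeffs p \<in> convex_coeffs"
  by (subst convex_coeffs_iff_sum[of "{0, 1}"]) (use assms in \<open>auto simp: binary_coeffs_def\<close>)

lemma sum_binary_coeffs: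
  "(\<Sum>i | binary_coeffs p i \<noteq> 0. binary_coeffs p i * f i) = p * f 0 + (1 - p) * f 1"
proof -
  have "(\<Sum>i | binary_coeffs p i \<noteq> 0. binary_coeffs p i * f i)
      = (\<Sum>i\<in>{0, 1}. binary_coeffs p i * f i)"
    by (rule sum.mono_neutral_left) (auto simp: binary_coeffs_def split: if_splits)
  then show ?thesis by (simp add: binary_coeffs_def)
qed

lemma convex_coeffs_mix:
  assumes "\<alpha> \<in> convex_coeffs" "\<beta> \<in> convex_coeffs" "p \<in> {0..1}"
  shows "(\<lambda>i. p * \<alpha> i + (1 - p) * \<beta> i) \<in> convex_coeffs"
proof -
  let ?F = "{i. \<alpha> i \<noteq> 0} \<union> {i. \<beta> i \<noteq> 0}"
  have fin: "finite ?F" using convex_coeffs_support(1) assms by auto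
  have "sum \<alpha> ?F = 1" "sum \<beta> ?F = 1"
    using convex_coeffs_iff_sum[OF fin, of \<alpha>] convex_coeffs_iff_sum[OF fin, of \<beta>] assms by auto
  then have "(\<Sum>i\<in>?F. p * \<alpha> i + (1 - p) * \<beta> i) = 1"
    by (simp add: sum.distrib flip: sum_distrib_left)
  then show ?thesis
    by (subst convex_coeffs_iff_sum[OF fin])
      (use assms convex_coeffs_support(2) in auto)
qed

section \<open>Binary convex combinations\<close>

context convex_space
begin

definition mix :: "real \<Rightarrow> 'a \<Rightarrow> 'a \<Rightarrow> 'a" where
  "mix p x y = cc (binary_coeffs p) (\<lambda>i. if i = 0 then x else y)"

lemma mix_in_carrier: "p \<in> {0..1} \<Longrightarrow> x \<in> A \<Longrightarrow> y \<in> A \<Longrightarrow> mix p x y \<in> A"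
  unfolding mix_def by (rule cc_closed) (auto intro: binary_coeffs_in_convex_coeffs)

text \<open>
  Binary mixing acts on coefficients over a common family of points. Hence an identity between
  nested binary combinations reduces to an identity between real coefficients.
\<close>
lemma mix_cc:
  assumes "\<alpha> \<in> convex_coeffs" "\<beta> \<in> convex_coeffs" "p \<in> {0..1}" "\<And>i. a i \<in> A"
  shows "mix p (cc \<alpha> a) (cc \<beta> a) = cc (\<lambda>i. p * \<alpha> i + (1 - p) * \<beta> i) a"
proof -
  have "mix p (cc \<alpha> a) (cc \<beta> a)
      = cc (binary_coeffs p) (\<lambda>i. cc (if i = 0 then \<alpha> else \<beta>) a)"
    unfolding mix_def by (rule arg_cong[of _ _ "cc _"]) auto
  also have "\<dots> = cc (\<lambda>j. \<Sum>i | binary_coeffs p i \<noteq> 0.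
                      binary_coeffs p i * (if i = 0 then \<alpha> else \<beta>) j) a"
    by (rule cc_assoc) (use assms in \<open>auto intro: binary_coeffs_in_convex_coeffs\<close>)
  finally show ?thesis by (simp add: sum_binary_coeffs)
qed

text \<open>
  A two-by-two combination may be grouped by rows or by columns. The hypotheses on \<open>k\<close> and \<open>l\<close> are
  stated without division, so that they remain meaningful when a column has total weight zero.
\<close>
lemma mix_regroup:
  assumes pts: "c \<in> A" "x \<in> A" "d \<in> A" "y \<in> A"
    and wts: "p \<in> {0..1}" "r \<in> {0..1}" "s \<in> {0..1}" "t \<in> {0..1}" "k \<in> {0..1}" "l \<in> {0..1}"
    and t: "t = p * r + (1 - p) * s"
    and k: "t * k = p * r"
    and l: "(1 - t) * l = p * (1 - r)"
  shows "mix p (mix r c x) (mix s d y) = mix t (mix k c d) (mix l x y)"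
proof -
  define a where "a = (\<lambda>i::nat. if i = 0 then c else if i = 1 then x else if i = 2 then d else y)"
  define e where "e = (\<lambda>j i::nat. if i = j then 1 else 0 :: real)"
  have a: "a i \<in> A" for i using pts by (simp add: a_def)
  have e: "e j \<in> convex_coeffs" for j unfolding e_def by (rule unit_in_convex_coeffs)
  have unit: "cc (e j) a = a j" for j unfolding e_def by (rule cc_unit) (rule a)
  have pt: "c = cc (e 0) a" "x = cc (e 1) a" "d = cc (e 2) a" "y = cc (e 3) a"
    unfolding unit by (simp_all add: a_def)
  have coeff: "p * (r * u + (1 - r) * v) + (1 - p) * (s * w + (1 - s) * z)
      = t * (k * u + (1 - k) * w) + (1 - t) * (l * v + (1 - l) * z)" for u v w z
  proof -
    have "t * (k * u + (1 - k) * w) + (1 - t) * (l * v + (1 - l) * z)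
        = (t * k) * u + (t - t * k) * w + ((1 - t) * l) * v + (1 - t - (1 - t) * l) * z"
      by (simp add: algebra_simps)
    then show ?thesis unfolding k l by (simp add: t algebra_simps)
  qed
  show ?thesis
    unfolding pt using wts by (simp only: mix_cc a e convex_coeffs_mix coeff)
qed

lemma mix_1: "x \<in> A \<Longrightarrow> y \<in> A \<Longrightarrow> mix 1 x y = x"
  using cc_unit[of "\<lambda>i. if i = 0 then x else y" 0]
  by (simp add: mix_def binary_coeffs_def cong: if_cong)

lemma mix_0: "x \<in> A \<Longrightarrow> y \<in> A \<Longrightarrow> mix 0 x y = y"
proof -
  assume "x \<in> A" "y \<in> A"
  moreover have "binary_coeffs 0 = (\<lambda>i. if i = 1 then 1 else 0)"
    by (auto simp: binary_coeffs_def)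
  ultimately show ?thesis
    using cc_unit[of "\<lambda>i. if i = 0 then x else y" 1] by (simp add: mix_def)
qed

lemma mix_same:
  assumes "x \<in> A" "p \<in> {0..1}"
  shows "mix p x x = x"
proof -
  let ?e = "\<lambda>i::nat. if i = 0 then 1 else 0 :: real"
  have x: "cc ?e (\<lambda>_. x) = x" by (rule cc_unit) (rule assms)
  have "mix p (cc ?e (\<lambda>_. x)) (cc ?e (\<lambda>_. x)) = cc (\<lambda>i. p * ?e i + (1 - p) * ?e i) (\<lambda>_. x)"
    by (rule mix_cc) (use assms unit_in_convex_coeffs in auto)
  also have "(\<lambda>i. p * ?e i + (1 - p) * ?e i) = ?e" by auto
  finally show ?thesis unfolding x .
qed

definition mix_closed :: "'a set \<Rightarrow> bool" where
  "mix_closed S \<longleftrightarrow> (\<forall>p\<in>{0..1}. \<forall>x\<in>S. \<forall>y\<in>S. mix p x y \<in> S)"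

text \<open>
  A combination with more than one nonzero weight is a binary mixture of one of its points and a
  combination of the remaining ones with rescaled weights, so induction on the size of the support
  applies.
\<close>
lemma closed_under_cc_if_mix_closed:
  assumes "S \<subseteq> A" "mix_closed S"
  shows "closed_under_cc cc S"
proof -
  have "cc \<alpha> a \<in> S" if "\<alpha> \<in> convex_coeffs" and aS: "\<And>i. a i \<in> S" for \<alpha> a
    using that(1)
  proof (induction "card {i. \<alpha> i \<noteq> 0}" arbitrary: \<alpha> rule: less_induct)
    case less
    note \<alpha> = convex_coeffs_support[OF less.prems]
    have a: "a i \<in> A" for i using aS assms(1) by blast
    obtain j where j: "\<alpha> j \<noteq> 0" using \<alpha>(4) by fastforce
    let ?e = "\<lambda>i. if i = j then 1 else 0 :: real"
    show ?case
    proof (cases "\<alpha> j = 1")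
      case True
      have "sum \<alpha> ({i. \<alpha> i \<noteq> 0} - {j}) = 0"
        using \<alpha>(1,4) j True by (simp add: sum_diff1)
      then have "\<forall>i \<in> {i. \<alpha> i \<noteq> 0} - {j}. \<alpha> i = 0"
        using \<alpha>(1,2) by (subst (asm) sum_nonneg_eq_0_iff) auto
      then have "\<alpha> = ?e" using True by (auto simp: fun_eq_iff)
      then show ?thesis using cc_unit[of a j] a aS by simp
    next
      case False
      then have lt: "\<alpha> j < 1" using \<alpha>(3)[of j] by simp
      define \<beta> where "\<beta> = (\<lambda>i. if i = j then 0 else \<alpha> i / (1 - \<alpha> j))"
      have supp: "{i. \<beta> i \<noteq> 0} = {i. \<alpha> i \<noteq> 0} - {j}"
        using lt by (auto simp: \<beta>_def)
      have "sum \<beta> ({i. \<alpha> i \<noteq> 0} - {j}) = (\<Sum>i \<in> {i. \<alpha> i \<noteq> 0} - {j}. \<alpha> i / (1 - \<alpha> j))"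
        by (rule sum.cong) (auto simp: \<beta>_def)
      also have "\<dots> = 1"
        using \<alpha>(1,4) j lt by (simp add: sum_diff1 flip: sum_divide_distrib)
      finally have \<beta>: "\<beta> \<in> convex_coeffs"
        using \<alpha>(1,2) lt
        by (subst convex_coeffs_iff_sum[of "{i. \<alpha> i \<noteq> 0} - {j}"]) (auto simp: \<beta>_def)
      have "card {i. \<beta> i \<noteq> 0} < card {i. \<alpha> i \<noteq> 0}"
        unfolding supp using \<alpha>(1) j by (intro card_Diff1_less) auto
      then have IH: "cc \<beta> a \<in> S" using less.hyps \<beta> by blast
      have "\<alpha> = (\<lambda>i. \<alpha> j * ?e i + (1 - \<alpha> j) * \<beta> i)"
        using lt by (auto simp: \<beta>_def)
      then have "cc \<alpha> a = mix (\<alpha> j) (cc ?e a) (cc \<beta> a)"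
        using mix_cc[of ?e \<beta> "\<alpha> j" a] unit_in_convex_coeffs \<beta> \<alpha>(2,3) a by simp
      also have "cc ?e a = a j" by (rule cc_unit) (rule a)
      finally show ?thesis using assms(2) aS IH \<alpha>(2,3) by (auto simp: mix_closed_def)
    qed
  qed
  then show ?thesis by (auto simp: closed_under_cc_def)
qed

section \<open>Separation of points by complementary convex sets\<close>

text \<open>
  For a nonempty convex set \<open>C\<close> this is the convex hull of \<open>C \<union> {x}\<close>.
\<close>
definition cone :: "'a \<Rightarrow> 'a set \<Rightarrow> 'a set" where
  "cone x C = {mix r c x | r c. r \<in> {0..1} \<and> c \<in> C}"

lemma cone_superset:
  assumes "C \<subseteq> A" "C \<noteq> {}" "x \<in> A"
  shows "insert x C \<subseteq> cone x C"
proof -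
  have "c \<in> cone x C" if "c \<in> C" for c
    using mix_1[of c x] that assms by (force simp: cone_def)
  moreover have "x \<in> cone x C"
    using mix_0[of _ x] assms by (force simp: cone_def)
  ultimately show ?thesis by blast
qed

lemma mix_closed_cone:
  assumes C: "C \<subseteq> A" "mix_closed C" and x: "x \<in> A"
  shows "mix_closed (cone x C)"
  unfolding mix_closed_def
proof (intro ballI)
  fix p u v assume p: "p \<in> {0..1::real}" and "u \<in> cone x C" "v \<in> cone x C"
  then obtain r c s d where r: "r \<in> {0..1}" "c \<in> C" "u = mix r c x"
    and s: "s \<in> {0..1}" "d \<in> C" "v = mix s d x"
    by (auto simp: cone_def)
  define t where "t = p * r + (1 - p) * s"
  define k where "k = p * r / t"
  define l where "l = p * (1 - r) / (1 - t)"
  have nonneg: "0 \<le> p * r" "0 \<le> (1 - p) * s" "0 \<le> p * (1 - r)" "0 \<le> (1 - p) * (1 - s)"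
    using p r s by auto
  have t': "1 - t = p * (1 - r) + (1 - p) * (1 - s)" by (simp add: t_def algebra_simps)
  have t: "t \<in> {0..1}" using nonneg t' by (auto simp: t_def)
  have k: "k \<in> {0..1}" "t * k = p * r"
    unfolding k_def t_def by (rule relative_weight[OF nonneg(1,2)])+
  have l: "l \<in> {0..1}" "(1 - t) * l = p * (1 - r)"
    unfolding l_def t' by (rule relative_weight[OF nonneg(3,4)])+
  have "mix p u v = mix t (mix k c d) (mix l x x)"
    unfolding r(3) s(3) using C r s p t k l x by (intro mix_regroup) (auto simp: t_def)
  also have "mix l x x = x" using x l(1) by (rule mix_same)
  finally have "mix p u v = mix t (mix k c d) x" .
  moreover have "mix k c d \<in> C" using C(2) k(1) r(2) s(2) unfolding mix_closed_def by blast
  ultimately show "mix p u v \<in> cone x C" using t unfolding cone_def by blast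
qed

text \<open>
  The point \<open>b\<close> lies on a segment from \<open>C\<close> to \<open>x\<close> and on one from \<open>C\<close> to \<open>y\<close>. Averaging the two
  expressions for \<open>b\<close> so that \<open>x\<close> and \<open>y\<close> contribute in the ratio \<open>q : (1 - q)\<close> lets these two points
  be merged into \<open>mix q x y\<close>, and \<open>b\<close> becomes a combination of points of \<open>C\<close> alone.
\<close>
lemma mem_if_mem_cones:
  assumes C: "C \<subseteq> A" "mix_closed C" and xy: "x \<in> A" "y \<in> A"
    and b: "b \<in> cone x C" "b \<in> cone y C"
    and q: "q \<in> {0..1}" "mix q x y \<in> C"
  shows "b \<in> C"
proof (rule ccontr)
  assume nb: "b \<notin> C"
  obtain r c s d where r: "r \<in> {0..1}" "c \<in> C" "b = mix r c x"
    and s: "s \<in> {0..1}" "d \<in> C" "b = mix s d y"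
    using b by (auto simp: cone_def)
  have "c \<in> A" "d \<in> A" using C r s by auto
  have "r \<noteq> 1" "s \<noteq> 1"
    using nb r s mix_1 \<open>c \<in> A\<close> \<open>d \<in> A\<close> xy by auto
  then have lt: "0 < 1 - r" "0 < 1 - s" using r s by auto
  define D where "D = q * (1 - s) + (1 - q) * (1 - r)"
  have nonneg: "0 \<le> q * (1 - s)" "0 \<le> (1 - q) * (1 - r)" using q lt by auto
  have "D \<noteq> 0"
  proof
    assume "D = 0"
    then have "q * (1 - s) = 0" "(1 - q) * (1 - r) = 0"
      using nonneg unfolding D_def by linarith+
    then show False using lt by auto
  qed
  then have D: "D > 0" using nonneg by (auto simp: D_def)
  (* The weight that solves p (1 - r) : (1 - p) (1 - s) = q : (1 - q). *)
  define p where "p = q * (1 - s) / D"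
  have p': "1 - p = (1 - q) * (1 - r) / D"
    using D by (simp add: p_def field_simps) (simp add: D_def algebra_simps)
  have p: "0 \<le> p" "0 \<le> 1 - p" unfolding p' unfolding p_def using nonneg D by auto
  define t where "t = p * r + (1 - p) * s"
  have "1 - t = p * (1 - r) + (1 - p) * (1 - s)" by (simp add: t_def algebra_simps)
  also have "\<dots> = (1 - r) * (1 - s) / D"
    unfolding p' unfolding p_def using D by (simp add: field_simps)
  finally have l: "(1 - t) * q = p * (1 - r)" by (simp add: p_def)
  have t: "0 \<le> t" "t \<le> 1"
  proof -
    show "0 \<le> t" using p r s by (auto simp: t_def)
    have "0 \<le> p * (1 - r) + (1 - p) * (1 - s)" using p lt by (intro add_nonneg_nonneg) auto
    then show "t \<le> 1" by (simp add: t_def algebra_simps)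
  qed
  define k where "k = p * r / t"
  have nonneg': "0 \<le> p * r" "0 \<le> (1 - p) * s" using p r s by auto
  have k: "k \<in> {0..1}" "t * k = p * r"
    unfolding k_def t_def by (rule relative_weight[OF nonneg'])+
  have "b \<in> A" using C r xy mix_in_carrier by auto
  then have "b = mix p b b" using p by (simp add: mix_same)
  also have "\<dots> = mix p (mix r c x) (mix s d y)" using r(3) s(3) by simp
  also have "\<dots> = mix t (mix k c d) (mix q x y)"
    using \<open>c \<in> A\<close> \<open>d \<in> A\<close> xy r(1) s(1) p q(1) t k l by (intro mix_regroup) (auto simp: t_def)
  also have "\<dots> \<in> C"
    using C(2) t k(1) r(2) s(2) q(2) by (auto simp: mix_closed_def)
  finally show False using nb by simp
qed

lemma boolean_subobject_separating:
  assumes "x \<in> A" "b \<in> A" "x \<noteq> b"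
  obtains C where "boolean_subobject A cc C" "x \<in> C" "b \<notin> C"
proof -
  define P where "P = {C. C \<subseteq> A \<and> mix_closed C \<and> x \<in> C \<and> b \<notin> C}"
  have "{x} \<in> P" using assms by (auto simp: P_def mix_closed_def mix_same)
  moreover have "\<Union>\<C> \<in> P" if ne: "\<C> \<noteq> {}" and ch: "subset.chain P \<C>" for \<C>
  proof -
    have sub: "\<And>C. C \<in> \<C> \<Longrightarrow> C \<in> P" using ch by (auto simp: subset.chain_def)
    have "mix p u v \<in> \<Union>\<C>" if "p \<in> {0..1}" "u \<in> \<Union>\<C>" "v \<in> \<Union>\<C>" for p u v
    proof -
      obtain U V where UV: "U \<in> \<C>" "u \<in> U" "V \<in> \<C>" "v \<in> V" using \<open>u \<in> \<Union>\<C>\<close> \<open>v \<in> \<Union>\<C>\<close> by blast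
      moreover have "U \<subseteq> V \<or> V \<subseteq> U"
        using ch UV by (auto simp: subset_chain_def)
      ultimately obtain W where W: "W \<in> \<C>" "u \<in> W" "v \<in> W" by blast
      then have "mix_closed W" using sub by (simp add: P_def)
      then show ?thesis using W \<open>p \<in> {0..1}\<close> unfolding mix_closed_def by blast
    qed
    then have "mix_closed (\<Union>\<C>)" unfolding mix_closed_def by blast
    moreover have "C \<subseteq> A" "x \<in> C" "b \<notin> C" if "C \<in> \<C>" for C
      using sub[OF that] by (simp_all add: P_def)
    ultimately show ?thesis using ne unfolding P_def by blast
  qed
  ultimately obtain C where CP: "C \<in> P" and max: "\<And>X. X \<in> P \<Longrightarrow> C \<subseteq> X \<Longrightarrow> X = C"
    using subset_Zorn_nonempty[of P] by blast
  have C: "C \<subseteq> A" "mix_closed C" "x \<in> C" "b \<notin> C" using CP by (auto simp: P_def)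
  have cone: "b \<in> cone u C" if u: "u \<in> A - C" for u
  proof (rule ccontr)
    assume "b \<notin> cone u C"
    moreover have sup: "insert u C \<subseteq> cone u C" using cone_superset C u by blast
    moreover have "cone u C \<subseteq> A" using C u mix_in_carrier by (auto simp: cone_def)
    ultimately have "cone u C \<in> P" using mix_closed_cone C u by (auto simp: P_def)
    then show False using max sup u by blast
  qed
  have "mix_closed (A - C)"
    unfolding mix_closed_def
    using mem_if_mem_cones[OF C(1,2)] cone C(4) mix_in_carrier by blast
  then have "boolean_subobject A cc C"
    using C closed_under_cc_if_mix_closed by (auto simp: boolean_subobject_def)
  then show thesis using that C by blast
qed

end

theorem mainTheorem5:
  fixes A :: "'a set" and cc :: "(nat \<Rightarrow> real) \<Rightarrow> (nat \<Rightarrow> 'a) \<Rightarrow> 'a"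
  assumes "convex_space A cc"
  shows "separated_space (Sigma_space A cc)"
  unfolding separated_space_def space_Sigma_space sets_Sigma_space
proof (intro ballI impI)
  fix x y assume "x \<in> A" "y \<in> A" "x \<noteq> y"
  then obtain C where "boolean_subobject A cc C" "x \<in> C" "y \<notin> C"
    using convex_space.boolean_subobject_separating[OF assms] by metis
  then show "\<exists>U\<in>sigma_sets A {S. boolean_subobject A cc S}. x \<in> U \<and> y \<notin> U \<or> y \<in> U \<and> x \<notin> U"
    by (intro bexI[of _ C] sigma_sets.Basic) auto
qed

end
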